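(* Let $\mathbb{K}$ be a field, let $V$ be a finite-dimensional $\mathbb{K}$-vector space, and let $\mathcal{A}$ be a central hyperplane arrangement in $V$. If $\mathcal{A}$ is hereditarily inductively factored, then for every linear subspace $U$ of $V$ the localization $\mathcal{A}_U=\{H\in\mathcal{A}\mid U\subseteq H\}$ (an arrangement in $V$) is hereditarily inductively factored.
   Context: Arrangements. A hyperplane arrangement $\mathcal{A}$ in a finite-dimensional $\mathbb{K}$-vector space $V$ is a finite collection (set) of hyperplanes in $V$. All arrangements are central, i.e. $0\in H$ for every $H\in\mathcal{A}$, so the hyperplanes are linear subspaces of codimension one. If $\dim V=\ell$, the empty arrangement in $V$ is denoted $\Phi_\ell$ (for each $\ell\ge 0$). The lattice $L(\mathcal{A})$ is the set of all intersections of subsets of $\mathcal{A}$, including $V$ as the intersection of the empty collection. For a linear subspace $U\subseteq V$, the localization of $\mathcal{A}$ at $U$ is $\mathcal{A}_U=\{H\in\mathcal{A}\mid U\subseteq H\}$. For $Y\in L(\mathcal{A})$, the restriction of $\mathcal{A}$ to $Y$ is the arrangement $\mathcal{A}^Y=\{Y\cap H\mid H\in\mathcal{A}\setminus\mathcal{A}_Y\}$ in the vector space $Y$ (as a set, without multiplicities); in particular $\mathcal{A}^V=\mathcal{A}$. Triples. For $\mathcal{A}$ non-empty and $H_0\in\mathcal{A}$, the triple associated with $H_0$ is $(\mathcal{A},\mathcal{A}',\mathcal{A}'')$, where $\mathcal{A}'=\mathcal{A}\setminus\{H_0\}$ is an arrangement in $V$ and $\mathcal{A}''=\mathcal{A}^{H_0}=\{H_0\cap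 H\mid H\in\mathcal{A}'\}$ is an arrangement in the vector space $H_0$. Partitions. Let $\pi=(\pi_1,\dots,\pi_s)$ be a partition of $\mathcal{A}$ into non-empty blocks; the numbering of the blocks is immaterial, and the block containing the chosen $H_0$ is labelled $\pi_1$. The partition of the empty arrangement is the empty one, with no non-empty blocks, written $(\varnothing)$. Given $H_0\in\pi_1$ and its triple: - the induced partition $\pi'$ of $\mathcal{A}'$ consists of the non-empty sets among $\pi_i\cap\mathcal{A}'$, $1\le i\le s$; - the restriction map is $\varrho=\varrho_{\pi,H_0}:\mathcal{A}\setminus\pi_1\to\mathcal{A}''$, $H\mapsto H\cap H_0$; - $\pi''=(\pi_2'',\dots,\pi_s'')$, where $\pi_i''=\varrho(\pi_i)=\{H\cap H_0\mid H\in\pi_i\}$ for $2\le i\le s$ (this is a partition of $\mathcal{A}''$ when $\varrho$ is bijective). Inductively factored arrangements. The class $\mathcal{IFAC}$ is the smallest class of pairs $(\mathcal{A},\pi)$, with $\mathcal{A}$ an arrangement and $\pi$ a partition of $\mathcal{A}$, such that: (i) $(\Phi_\ell,(\varnothing))\in\mathcal{IFAC}$ for each $\ell\ge 0$; (ii) if there exist a partition $\pi$ of $\mathcal{A}$ and a hyperplane $H_0\in\pi_1$ such that, for the triple $(\mathcal{A},\mathcal{A}',\mathcal{A}'')$ associated with $H_0$, the restriction map $\varrho_{\pi,H_0}:\mathcal{A}\setminus\pi_1\to\mathcal{A}''$ is bijective and both $(\mathcal{A}',\pi')$ and $(\mathcal{A}'',\pi'')$ belong to $\mathcal{IFAC}$,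 then $(\mathcal{A},\pi)$ belongs to $\mathcal{IFAC}$. An arrangement $\mathcal{A}$ is inductively factored if there is a partition $\pi$ of $\mathcal{A}$ with $(\mathcal{A},\pi)\in\mathcal{IFAC}$. An arrangement $\mathcal{A}$ is hereditarily inductively factored if $\mathcal{A}^Y$ is inductively factored for every $Y\in L(\mathcal{A})$. *)

theory Defs
  imports Complex_Main "HOL-Library.Disjoint_Sets"
begin

text \<open>
  The vector space \<open>V\<close> is the whole carrier type.  Since restrictions are arrangements in proper
  subspaces of \<open>V\<close>, every notion carries the ambient subspace \<open>W\<close> as an explicit argument.
\<close>

context finite_dimensional_vector_space
begin

definition hyperplane_in :: "'b set \<Rightarrow> 'b set \<Rightarrow> bool" where
  "hyperplane_in W H \<longleftrightarrow> subspace H \<and> H \<subseteq> W \<and> dim W = dim H + 1"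

definition arrangement :: "'b set \<Rightarrow> 'b set set \<Rightarrow> bool" where
  "arrangement W \<A> \<longleftrightarrow> subspace W \<and> finite \<A> \<and> (\<forall>H\<in>\<A>. hyperplane_in W H)"

end

text \<open>Intersecting with \<open>W\<close> makes \<open>W\<close> itself the intersection of the empty subfamily.\<close>

definition intersection_lattice :: "'b set \<Rightarrow> 'b set set \<Rightarrow> 'b set set" where
  "intersection_lattice W \<A> = {W \<inter> \<Inter>\<B> | \<B>. \<B> \<subseteq> \<A>}"

definition localization :: "'b set set \<Rightarrow> 'b set \<Rightarrow> 'b set set" where
  "localization \<A> U = {H \<in> \<A>. U \<subseteq> H}"

definition restriction :: "'b set set \<Rightarrow> 'b set \<Rightarrow> 'b set set" where
  "restriction \<A> Y = {Y \<inter> H | H. H \<in> \<A> - localization \<A> Y}"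

text \<open>
  Partitions are unordered sets of non-empty blocks (\<^const>\<open>partition_on\<close>).  In the second
  operation the block \<open>\<pi>\<^sub>1\<close> is the one containing the distinguished hyperplane.
\<close>

definition deletion_partition :: "'b set set set \<Rightarrow> 'b set \<Rightarrow> 'b set set set" where
  "deletion_partition \<pi> H\<^sub>0 = {B - {H\<^sub>0} | B. B \<in> \<pi>} - {{}}"

definition restriction_partition ::
    "'b set set set \<Rightarrow> 'b set set \<Rightarrow> 'b set \<Rightarrow> 'b set set set" where
  "restriction_partition \<pi> \<pi>\<^sub>1 H\<^sub>0 = {(\<lambda>H. H \<inter> H\<^sub>0) ` B | B. B \<in> \<pi> - {\<pi>\<^sub>1}}"

context finite_dimensional_vector_space
begin

lemma restriction_hyperplane:
  assumes "arrangement W \<A>" "H\<^sub>0 \<in> \<A>"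
  shows "restriction \<A> H\<^sub>0 = {H\<^sub>0 \<inter> H | H. H \<in> \<A> - {H\<^sub>0}}"
proof -
  have "H = H\<^sub>0" if "H \<in> \<A>" "H\<^sub>0 \<subseteq> H" for H
  proof -
    have "hyperplane_in W H\<^sub>0" "hyperplane_in W H"
      using assms that by (auto simp: arrangement_def)
    then have "subspace H\<^sub>0" "subspace H" "dim H\<^sub>0 = dim H"
      by (auto simp: hyperplane_in_def)
    then show ?thesis
      using that(2) subspace_dim_equal by (metis order_refl)
  qed
  then have "localization \<A> H\<^sub>0 = {H\<^sub>0}"
    using assms(2) by (auto simp: localization_def)
  then show ?thesis
    by (simp add: restriction_def)
qed

lemma restriction_ambient:
  assumes "arrangement W \<A>"
  shows "restriction \<A> W = \<A>"
proof -
  have sub: "H \<subseteq> W" and ne: "\<not> W \<subseteq> H" if "H \<in> \<A>" for H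
  proof -
    have "hyperplane_in W H"
      using assms that by (simp add: arrangement_def)
    then show "H \<subseteq> W" "\<not> W \<subseteq> H"
      using dim_subset[of W H] by (auto simp: hyperplane_in_def)
  qed
  have "W \<inter> H = H" if "H \<in> \<A>" for H
    using sub[OF that] by blast
  moreover have "localization \<A> W = {}"
    using ne by (auto simp: localization_def)
  ultimately show ?thesis
    unfolding restriction_def by force
qed

inductive IFAC :: "'b set \<Rightarrow> 'b set set \<Rightarrow> 'b set set set \<Rightarrow> bool" where
  empty: "subspace W \<Longrightarrow> IFAC W {} {}"
| step: "\<lbrakk>arrangement W \<A>; partition_on \<A> \<pi>; \<pi>\<^sub>1 \<in> \<pi>; H\<^sub>0 \<in> \<pi>\<^sub>1;
    bij_betw (\<lambda>H. H \<inter> H\<^sub>0) (\<A> - \<pi>\<^sub>1) (restriction \<A> H\<^sub>0);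
    IFAC W (\<A> - {H\<^sub>0}) (deletion_partition \<pi> H\<^sub>0);
    IFAC H\<^sub>0 (restriction \<A> H\<^sub>0) (restriction_partition \<pi> \<pi>\<^sub>1 H\<^sub>0)\<rbrakk>
    \<Longrightarrow> IFAC W \<A> \<pi>"

definition inductively_factored :: "'b set \<Rightarrow> 'b set set \<Rightarrow> bool" where
  "inductively_factored W \<A> \<longleftrightarrow> (\<exists>\<pi>. partition_on \<A> \<pi> \<and> IFAC W \<A> \<pi>)"

definition hereditarily_inductively_factored :: "'b set \<Rightarrow> 'b set set \<Rightarrow> bool" where
  "hereditarily_inductively_factored W \<A> \<longleftrightarrow>
    (\<forall>Y\<in>intersection_lattice W \<A>. inductively_factored Y (restriction \<A> Y))"

end

end

theory Submission imports Defs begin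

text \<open>
  Localizing at \<open>U\<close> commutes with every operation from which the class \<open>IFAC\<close> is built.  The reason
  is the trivial remark that for \<open>U \<subseteq> Y\<close> one has \<open>U \<subseteq> Y \<inter> H\<close> if and only if \<open>U \<subseteq> H\<close>: whether a
  hyperplane survives the localization can be read off before or after restricting to \<open>Y\<close>.

  Hence an inductive construction of \<open>(\<A>, \<pi>)\<close> turns into one of \<open>(\<A>\<^sub>U, \<pi>\<^sub>U)\<close>, where the blocks of
  \<open>\<pi>\<^sub>U\<close> are the non-empty traces on \<open>\<A>\<^sub>U\<close> of the blocks of \<open>\<pi>\<close> (lemma \<open>IFAC_localization\<close>).
  A step that adds a hyperplane \<open>H\<^sub>0\<close> with \<open>U \<subseteq> H\<^sub>0\<close> becomes the step that adds \<open>H\<^sub>0\<close> to the localized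
  deletion, and a step with \<open>\<not> U \<subseteq> H\<^sub>0\<close> changes nothing and is skipped.

  For the hereditary property, any \<open>Y\<close> in the lattice of \<open>\<A>\<^sub>U\<close> lies in the lattice of \<open>\<A>\<close> and contains
  \<open>U\<close>, so that \<open>(\<A>\<^sub>U)\<^sup>Y = (\<A>\<^sup>Y)\<^sub>U\<close> is a localization of an inductively factored arrangement.
\<close>

definition localization_partition :: "'b set set set \<Rightarrow> 'b set \<Rightarrow> 'b set set set" where
  "localization_partition \<pi> U = (\<lambda>B. localization B U) ` \<pi> - {{}}"

lemma partition_on_localization:
  assumes "partition_on \<A> \<pi>"
  shows "partition_on (localization \<A> U) (localization_partition \<pi> U)"
proof -
  have "(\<lambda>B. localization B U) ` \<pi> = (\<inter>) {H. U \<subseteq> H} ` \<pi>"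
    by (rule image_cong) (auto simp: localization_def)
  moreover have "localization \<A> U = {H. U \<subseteq> H} \<inter> \<A>"
    by (auto simp: localization_def)
  ultimately show ?thesis
    using partition_on_restrict[OF assms, of "{H. U \<subseteq> H}"]
    by (simp add: localization_partition_def)
qed

lemma restriction_localization:
  assumes "U \<subseteq> Y"
  shows "restriction (localization \<A> U) Y = localization (restriction \<A> Y) U"
  using assms by (auto simp: restriction_def localization_def)

lemma image_Diff_empty:
  "f {} = {} \<Longrightarrow> f ` (S - {{}}) - {{}} = f ` S - {{}}"
  by auto

lemma deletion_partition_localization:
  "deletion_partition (localization_partition \<pi> U) H\<^sub>0
    = localization_partition (deletion_partition \<pi> H\<^sub>0) U"
proof -
  have comm: "localization (B - {H\<^sub>0}) U = localization B U - {H\<^sub>0}" for B :: "'a set set"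
    by (auto simp: localization_def)
  have empty: "localization {} U = {}"
    by (simp add: localization_def)
  show ?thesis
    unfolding deletion_partition_def localization_partition_def Setcompr_eq_image
    by (simp add: image_Diff_empty image_image comm empty)
qed

lemma localization_deletion_not_above:
  assumes "\<not> U \<subseteq> H\<^sub>0"
  shows "localization (\<A> - {H\<^sub>0}) U = localization \<A> U"
  using assms by (auto simp: localization_def)

lemma localization_partition_deletion_not_above:
  assumes "\<not> U \<subseteq> H\<^sub>0"
  shows "localization_partition (deletion_partition \<pi> H\<^sub>0) U = localization_partition \<pi> U"
proof -
  have "B - {H\<^sub>0} = B" if "B \<in> localization_partition \<pi> U" for B
    using that assms by (auto simp: localization_partition_def localization_def)
  then have "{B - {H\<^sub>0} | B. B \<in> localization_partition \<pi> U} = localization_partition \<pi> U"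
    by force
  then have "deletion_partition (localization_partition \<pi> U) H\<^sub>0 = localization_partition \<pi> U"
    by (simp add: deletion_partition_def localization_partition_def)
  then show ?thesis
    by (simp add: deletion_partition_localization)
qed

text \<open>
  Disjointness of blocks enters here: localizing must not identify another block with the
  distinguished one, since the left-hand side leaves out every block with the trace of \<open>\<pi>\<^sub>1\<close>.
\<close>

lemma restriction_partition_localization:
  assumes "partition_on \<A> \<pi>" "\<pi>\<^sub>1 \<in> \<pi>" "U \<subseteq> H\<^sub>0"
  shows "restriction_partition (localization_partition \<pi> U) (localization \<pi>\<^sub>1 U) H\<^sub>0
    = localization_partition (restriction_partition \<pi> \<pi>\<^sub>1 H\<^sub>0) U"
proof -
  have image: "localization ((\<lambda>H. H \<inter> H\<^sub>0) ` B) U = (\<lambda>H. H \<inter> H\<^sub>0) ` localization B U" for B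
    using assms(3) by (auto simp: localization_def)
  have "localization B U \<noteq> localization \<pi>\<^sub>1 U"
    if "B \<in> \<pi>" "B \<noteq> \<pi>\<^sub>1" "localization B U \<noteq> {}" for B
  proof -
    have "B \<inter> \<pi>\<^sub>1 = {}"
      using partition_onD2[OF assms(1)] assms(2) that by (auto dest: disjointD)
    then show ?thesis
      using that(3) by (auto simp: localization_def)
  qed
  then have blocks: "localization_partition \<pi> U - {localization \<pi>\<^sub>1 U}
      = localization_partition (\<pi> - {\<pi>\<^sub>1}) U"
    unfolding localization_partition_def by blast
  have "restriction_partition (localization_partition \<pi> U) (localization \<pi>\<^sub>1 U) H\<^sub>0
      = (`) (\<lambda>H. H \<inter> H\<^sub>0) ` localization_partition (\<pi> - {\<pi>\<^sub>1}) U"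
    unfolding restriction_partition_def blocks by blast
  also have "\<dots> = (\<lambda>B. (\<lambda>H. H \<inter> H\<^sub>0) ` localization B U) ` (\<pi> - {\<pi>\<^sub>1}) - {{}}"
    unfolding localization_partition_def by blast
  also have "\<dots> = localization_partition (restriction_partition \<pi> \<pi>\<^sub>1 H\<^sub>0) U"
    unfolding localization_partition_def restriction_partition_def
    by (auto simp: image[symmetric])
  finally show ?thesis .
qed

text \<open>
  A preimage under the restriction map of a member containing \<open>U\<close> contains \<open>U\<close> itself, so that the
  bijection cuts down to the localizations.
\<close>

lemma bij_betw_localization:
  assumes "bij_betw (\<lambda>H. H \<inter> H\<^sub>0) (\<A> - \<pi>\<^sub>1) (restriction \<A> H\<^sub>0)" "U \<subseteq> H\<^sub>0"
  shows "bij_betw (\<lambda>H. H \<inter> H\<^sub>0) (localization \<A> U - localization \<pi>\<^sub>1 U)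
    (restriction (localization \<A> U) H\<^sub>0)"
proof -
  have "localization \<A> U - localization \<pi>\<^sub>1 U = localization (\<A> - \<pi>\<^sub>1) U"
    by (auto simp: localization_def)
  moreover have "(\<lambda>H. H \<inter> H\<^sub>0) ` localization (\<A> - \<pi>\<^sub>1) U
      = localization ((\<lambda>H. H \<inter> H\<^sub>0) ` (\<A> - \<pi>\<^sub>1)) U"
    using assms(2) by (auto simp: localization_def)
  moreover have "inj_on (\<lambda>H. H \<inter> H\<^sub>0) (localization (\<A> - \<pi>\<^sub>1) U)"
    using assms(1) by (auto simp: bij_betw_def localization_def intro: inj_on_subset)
  ultimately show ?thesis
    using assms(1) by (simp add: bij_betw_def restriction_localization[OF assms(2)])
qed

context finite_dimensional_vector_space
begin

lemma arrangement_localization: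
  "arrangement W \<A> \<Longrightarrow> arrangement W (localization \<A> U)"
  by (auto simp: arrangement_def localization_def)

lemma IFAC_localization:
  assumes "IFAC W \<A> \<pi>"
  shows "IFAC W (localization \<A> U) (localization_partition \<pi> U)"
  using assms
proof induction
  case (empty W)
  then show ?case
    by (simp add: localization_def localization_partition_def IFAC.empty)
next
  case (step W \<A> \<pi> \<pi>\<^sub>1 H\<^sub>0)
  show ?case
  proof (cases "U \<subseteq> H\<^sub>0")
    case False
    then show ?thesis
      using step.IH(1)
      by (simp add: localization_deletion_not_above localization_partition_deletion_not_above)
  next
    case True
    have H\<^sub>0: "H\<^sub>0 \<in> localization \<pi>\<^sub>1 U"
      using True step.hyps by (simp add: localization_def)
    have block: "localization \<pi>\<^sub>1 U \<in> localization_partition \<pi> U"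
      using H\<^sub>0 step.hyps by (auto simp: localization_partition_def)
    have "localization (\<A> - {H\<^sub>0}) U = localization \<A> U - {H\<^sub>0}"
      by (auto simp: localization_def)
    then have deletion: "IFAC W (localization \<A> U - {H\<^sub>0})
        (deletion_partition (localization_partition \<pi> U) H\<^sub>0)"
      using step.IH(1) by (simp add: deletion_partition_localization)
    have restriction: "IFAC H\<^sub>0 (restriction (localization \<A> U) H\<^sub>0)
        (restriction_partition (localization_partition \<pi> U) (localization \<pi>\<^sub>1 U) H\<^sub>0)"
      using step.IH(2) restriction_partition_localization[OF step.hyps(2,3) True]
      by (simp add: restriction_localization[OF True])
    show ?thesis
      by (rule IFAC.step[OF arrangement_localization[OF step.hyps(1)]
          partition_on_localization[OF step.hyps(2)] block H\<^sub>0
          bij_betw_localization[OF step.hyps(5) True] deletion restriction])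
  qed
qed

lemma inductively_factored_localization:
  assumes "inductively_factored W \<A>"
  shows "inductively_factored W (localization \<A> U)"
  using assms IFAC_localization partition_on_localization
  unfolding inductively_factored_def by blast

lemma hereditarily_inductively_factored_localization:
  assumes "hereditarily_inductively_factored W \<A>" "U \<subseteq> W"
  shows "hereditarily_inductively_factored W (localization \<A> U)"
  unfolding hereditarily_inductively_factored_def
proof
  fix Y
  assume "Y \<in> intersection_lattice W (localization \<A> U)"
  then obtain \<B> where \<B>: "\<B> \<subseteq> localization \<A> U" "Y = W \<inter> \<Inter>\<B>"
    by (auto simp: intersection_lattice_def)
  then have "U \<subseteq> Y" "Y \<in> intersection_lattice W \<A>"
    using assms(2) by (auto simp: intersection_lattice_def localization_def)
  then show "inductively_factored Y (restriction (localization \<A> U) Y)"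
    using assms(1) inductively_factored_localization
    by (simp add: hereditarily_inductively_factored_def restriction_localization)
qed

end

theorem mainTheorem2:
  fixes scale :: "'k::field \<Rightarrow> 'v::ab_group_add \<Rightarrow> 'v"
    and Basis :: "'v set"
    and \<A> :: "'v set set"
    and U :: "'v set"
  assumes "finite_dimensional_vector_space scale Basis"
    and "finite_dimensional_vector_space.arrangement scale UNIV \<A>"
    and "finite_dimensional_vector_space.hereditarily_inductively_factored scale UNIV \<A>"
    and "module.subspace scale U"
  shows "finite_dimensional_vector_space.hereditarily_inductively_factored scale UNIV
    (localization \<A> U)"
  using finite_dimensional_vector_space.hereditarily_inductively_factored_localization
    [OF assms(1,3)] by simp

end
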